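(* Let $H$ be a complex Hilbert space and let $T=V|T|$ be the polar decomposition of an operator $T\in\mathcal{B}(H)$. Suppose that $\ker(T)=\ker(T^* )$. Then the following assertions are equivalent: (1) $M(T)$ is normal; (2) $V^*|T|V=V|T|V^*$; (3) $V^2|T|=|T|V^2$; (4) $M(T^* )=M(T)^*$.
   Context: $\mathcal{B}(H)$ is the algebra of bounded linear operators on $H$. For $A\in\mathcal{B}(H)$, $|A|=(A^*A)^{1/2}$, and the polar decomposition $A=W|A|$ is the canonical one: $W$ is the unique partial isometry with $A=W|A|$ and $\ker(W)=\ker(A)$. The mean transform of $A$ with polar decomposition $A=W|A|$ is $M(A)=\frac12(A+|A|W)$. In particular $M(T^* )$ is computed from the polar decomposition $T^*=V^*|T^*|$ of $T^*$. *)

theory Defs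
  imports "HOL-Analysis.Analysis"
begin

text \<open>
  Complex inner product spaces are built on top of \<^class>\<open>real_inner\<close>: the real inner product is
  required to be the real part of the complex one.  This loses no generality (given a complex
  inner product, take its real part) and makes the norm
  \<open>norm x = sqrt (x \<bullet> x) = sqrt (Re (cinner x x))\<close> and the topology the usual ones.
  Positive definiteness of \<open>cinner\<close> follows from that of the real inner product, since
  \<open>cinner x x\<close> is real by conjugate symmetry.  The inner product is linear in its first argument.
\<close>

class complex_inner = real_inner +
  fixes scaleC :: "complex \<Rightarrow> 'a \<Rightarrow> 'a" (infixr "*\<^sub>C" 75)
    and cinner :: "'a \<Rightarrow> 'a \<Rightarrow> complex"
  assumes scaleC_add_right: "c *\<^sub>C (x + y) = c *\<^sub>C x + c *\<^sub>C y"
    and scaleC_add_left: "(c + d) *\<^sub>C x = c *\<^sub>C x + d *\<^sub>C x"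
    and scaleC_scaleC: "c *\<^sub>C d *\<^sub>C x = (c * d) *\<^sub>C x"
    and scaleC_of_real: "complex_of_real r *\<^sub>C x = r *\<^sub>R x"
    and cinner_add_left: "cinner (x + y) z = cinner x z + cinner y z"
    and cinner_scaleC_left: "cinner (c *\<^sub>C x) y = c * cinner x y"
    and cinner_commute: "cinner x y = cnj (cinner y x)"
    and Re_cinner: "Re (cinner x y) = x \<bullet> y"

class chilbert_space = complex_inner + complete_space

definition bounded_clinear :: "('a::complex_inner \<Rightarrow> 'b::complex_inner) \<Rightarrow> bool" where
  "bounded_clinear A \<longleftrightarrow> bounded_linear A \<and> (\<forall>c x. A (c *\<^sub>C x) = c *\<^sub>C A x)"

definition cadjoint :: "('a::chilbert_space \<Rightarrow> 'a) \<Rightarrow> ('a \<Rightarrow> 'a)" where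
  "cadjoint A = (THE B. bounded_clinear B \<and> (\<forall>x y. cinner (A x) y = cinner x (B y)))"

definition normal_op :: "('a::chilbert_space \<Rightarrow> 'a) \<Rightarrow> bool" where
  "normal_op A \<longleftrightarrow> bounded_clinear A \<and> A \<circ> cadjoint A = cadjoint A \<circ> A"

definition positive_op :: "('a::chilbert_space \<Rightarrow> 'a) \<Rightarrow> bool" where
  "positive_op A \<longleftrightarrow> bounded_clinear A \<and> (\<forall>x. cinner (A x) x \<in> \<real>\<^sub>\<ge>\<^sub>0)"

definition op_sqrt :: "('a::chilbert_space \<Rightarrow> 'a) \<Rightarrow> ('a \<Rightarrow> 'a)" where
  "op_sqrt A = (THE R. positive_op R \<and> R \<circ> R = A)"

definition op_abs :: "('a::chilbert_space \<Rightarrow> 'a) \<Rightarrow> ('a \<Rightarrow> 'a)" where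
  "op_abs A = op_sqrt (cadjoint A \<circ> A)"

definition ker :: "('a::complex_inner \<Rightarrow> 'b::complex_inner) \<Rightarrow> 'a set" where
  "ker A = {x. A x = 0}"

definition partial_isometry :: "('a::chilbert_space \<Rightarrow> 'a) \<Rightarrow> bool" where
  "partial_isometry W \<longleftrightarrow>
     bounded_clinear W \<and> (\<forall>x. (\<forall>y\<in>ker W. cinner x y = 0) \<longrightarrow> norm (W x) = norm x)"

definition polar_decomposition :: "('a::chilbert_space \<Rightarrow> 'a) \<Rightarrow> ('a \<Rightarrow> 'a) \<Rightarrow> bool" where
  "polar_decomposition A W \<longleftrightarrow> partial_isometry W \<and> A = W \<circ> op_abs A \<and> ker W = ker A"

definition mean_transform :: "('a::chilbert_space \<Rightarrow> 'a) \<Rightarrow> ('a \<Rightarrow> 'a)" where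
  "mean_transform A =
     (let W = (THE W. polar_decomposition A W) in (\<lambda>x. (1 / 2) *\<^sub>R (A x + op_abs A (W x))))"

end

theory Submission imports Defs begin

text \<open>
  Write \<open>P = |T|\<close>.  The hypothesis \<open>ker T = ker T\<^sup>*\<close> says that \<open>V\<close> and \<open>V\<^sup>*\<close> have the same kernel, so
  that \<open>VV\<^sup>*\<close> and \<open>V\<^sup>*V\<close> are the same projection (\<open>partial_isometry_normal\<close>).  This projection leaves \<open>V\<close>, \<open>V\<^sup>*\<close>
  and \<open>P\<close> fixed when multiplied to them from either side, that is, \<open>V\<close> is unitary on the orthogonal
  complement of \<open>ker T\<close>.  Moreover \<open>|T\<^sup>*| = VPV\<^sup>*\<close>, and \<open>T\<^sup>* = V\<^sup>*|T\<^sup>*|\<close> is a polar decomposition, so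
    \<open>2 M(T) = VP + PV\<close>,  \<open>2 M(T)\<^sup>* = PV\<^sup>* + V\<^sup>*P\<close>,  \<open>2 M(T\<^sup>*) = PV\<^sup>* + VPV\<^sup>*V\<^sup>*\<close>.
  Hence \<open>M(T\<^sup>*) = M(T)\<^sup>*\<close> means \<open>VPV\<^sup>*V\<^sup>* = V\<^sup>*P\<close>.  This equation and \<open>V\<^sup>*PV = VPV\<^sup>*\<close> both turn into
  \<open>V\<^sup>2P = PV\<^sup>2\<close>, and back, on multiplication by suitable powers of \<open>V\<close> and \<open>V\<^sup>*\<close>.

  For normality, the key is that both products are perfect squares:
    \<open>4 M(T)M(T)\<^sup>* = (VPV\<^sup>* + P)\<^sup>2\<close>  and  \<open>4 M(T)\<^sup>*M(T) = (V\<^sup>*PV + P)\<^sup>2\<close>.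
  The operators in parentheses are positive, so by uniqueness of positive square roots
  (\<open>positive_op_sqrt_unique\<close>) the products agree iff \<open>VPV\<^sup>* = V\<^sup>*PV\<close>.

  The analytic basis consists of the Riesz representation theorem, which gives adjoints, and
  of the existence of a positive square root that commutes with everything its square commutes with
  (\<open>positive_op_sqrt_exists\<close>), which gives \<open>|T|\<close> and the uniqueness of square roots.
  The identity \<open>VV\<^sup>*V = V\<close> behind the algebra of partial isometries follows from the fact that \<open>V\<close>
  preserves the norm on the range of \<open>V\<^sup>*\<close> (\<open>partial_isometry_cadjoint_absorb\<close>).
\<close>

section \<open>Bounded complex-linear maps\<close>

instance chilbert_space \<subseteq> banach ..

lemma
  assumes "bounded_clinear A"
  shows bounded_clinear_add: "A (x + y) = A x + A y"
    and bounded_clinear_diff: "A (x - y) = A x - A y"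
    and bounded_clinear_scaleR: "A (r *\<^sub>R x) = r *\<^sub>R A x"
    and bounded_clinear_zero: "A 0 = 0"
  using assms bounded_linear.linear[of A] unfolding bounded_clinear_def
  by (auto simp: linear_add linear_diff linear_scale linear_0)

lemmas bounded_clinear_simps =
  bounded_clinear_add bounded_clinear_diff bounded_clinear_scaleR bounded_clinear_zero

lemma bounded_clinear_scaleC: "bounded_clinear A \<Longrightarrow> A (c *\<^sub>C x) = c *\<^sub>C A x"
  by (simp add: bounded_clinear_def)

lemma scaleC_scaleR_commute: "c *\<^sub>C (r *\<^sub>R (x::'a::complex_inner)) = r *\<^sub>R (c *\<^sub>C x)"
  by (simp add: scaleC_of_real [symmetric] scaleC_scaleC mult.commute)

lemma scaleC_minus_right: "c *\<^sub>C (- (x::'a::complex_inner)) = - (c *\<^sub>C x)"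
  using scaleC_scaleR_commute[of c "-1" x] by simp

lemma scaleC_diff_right: "c *\<^sub>C (x - y) = c *\<^sub>C x - c *\<^sub>C (y::'a::complex_inner)"
  using scaleC_add_right[of c x "- y"] by (simp add: scaleC_minus_right)

lemma bounded_clinear_ident: "bounded_clinear (\<lambda>x. x)"
  by (simp add: bounded_clinear_def)

lemma bounded_clinear_compose:
  "bounded_clinear A \<Longrightarrow> bounded_clinear B \<Longrightarrow> bounded_clinear (\<lambda>x. A (B x))"
  by (auto simp: bounded_clinear_def intro: bounded_linear_compose)

lemma bounded_clinear_sum:
  "bounded_clinear A \<Longrightarrow> bounded_clinear B \<Longrightarrow> bounded_clinear (\<lambda>x. A x + B x)"
  by (auto simp: bounded_clinear_def scaleC_add_right intro: bounded_linear_add)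

lemma bounded_clinear_difference:
  "bounded_clinear A \<Longrightarrow> bounded_clinear B \<Longrightarrow> bounded_clinear (\<lambda>x. A x - B x)"
  by (auto simp: bounded_clinear_def scaleC_diff_right intro: bounded_linear_sub)

lemma bounded_clinear_const_scaleR:
  "bounded_clinear A \<Longrightarrow> bounded_clinear (\<lambda>x. r *\<^sub>R A x)"
  by (auto simp: bounded_clinear_def scaleC_scaleR_commute
      intro: bounded_linear_compose[OF bounded_linear_scaleR_right])

lemmas bounded_clinear_intros = bounded_clinear_ident
  bounded_clinear_sum bounded_clinear_difference bounded_clinear_const_scaleR

lemma bounded_clinearI:
  assumes "\<And>x y. A (x + y) = A x + A y" "\<And>c x. A (c *\<^sub>C x) = c *\<^sub>C A x"
    and "\<And>x. norm (A x) \<le> K * norm x"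
  shows "bounded_clinear A"
  unfolding bounded_clinear_def
proof (intro conjI allI assms(2) bounded_linear_intro)
  show "A (r *\<^sub>R x) = r *\<^sub>R A x" for r x
    using assms(2)[of "of_real r" x] by (simp add: scaleC_of_real)
  show "norm (A x) \<le> norm x * K" for x using assms(3) by (simp add: mult.commute)
qed (rule assms)

section \<open>Adjoints\<close>

lemma cinner_eq_inner:
  "cinner x y = Complex (x \<bullet> y) (x \<bullet> (\<i> *\<^sub>C y))"
proof -
  have "cinner x (\<i> *\<^sub>C y) = - \<i> * cinner x y"
    by (metis cinner_commute cinner_scaleC_left complex_cnj_i complex_cnj_mult)
  hence "Im (cinner x y) = x \<bullet> (\<i> *\<^sub>C y)"
    by (simp flip: Re_cinner)
  thus ?thesis by (simp add: complex_eq_iff Re_cinner)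
qed

lemma inner_scaleC_left: "(c *\<^sub>C x) \<bullet> y = x \<bullet> (cnj c *\<^sub>C (y::'a::complex_inner))"
proof -
  have "cinner x (cnj c *\<^sub>C y) = c * cinner x y"
    by (metis cinner_commute cinner_scaleC_left complex_cnj_cnj complex_cnj_mult)
  thus ?thesis by (metis Re_cinner cinner_scaleC_left)
qed

lemma norm_scaleC: "norm (c *\<^sub>C (x::'a::complex_inner)) = cmod c * norm x"
proof -
  have "(norm (c *\<^sub>C x))\<^sup>2 = x \<bullet> (complex_of_real ((cmod c)\<^sup>2) *\<^sub>C x)"
    by (simp only: power2_norm_eq_inner[of "c *\<^sub>C x"] inner_scaleC_left scaleC_scaleC
        complex_norm_square mult.commute[of "cnj c"])
  also have "\<dots> = (cmod c * norm x)\<^sup>2"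
    by (simp only: scaleC_of_real inner_scaleR_right power_mult_distrib power2_norm_eq_inner)
  finally show ?thesis by (simp add: power2_eq_iff_nonneg)
qed

text \<open>The minimiser of \<open>\<parallel>x\<parallel>\<^sup>2 - 2 f x\<close> represents \<open>f\<close>: the parallelogram law makes every minimising
  sequence Cauchy, and at the minimiser the derivative in each direction vanishes.\<close>

lemma riesz_representation:
  fixes f :: "'a::{real_inner,complete_space} \<Rightarrow> real"
  assumes "bounded_linear f"
  obtains z where "\<And>x. f x = z \<bullet> x"
proof -
  interpret f: bounded_linear f by fact
  define J where "J x = x \<bullet> x - 2 * f x" for x
  obtain K where K: "\<And>x. norm (f x) \<le> norm x * K" using f.bounded by blast
  have "- K\<^sup>2 \<le> J x" for x
  proof -
    have "f x \<le> norm x * K" using K[of x] by simp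
    moreover have "0 \<le> (norm x - K)\<^sup>2" by simp
    ultimately show ?thesis
      unfolding J_def by (simp add: power2_diff dot_square_norm)
  qed
  hence bdd: "bdd_below (range J)" by (intro bdd_belowI2)
  define m where "m = Inf (range J)"
  have m: "m \<le> J x" for x unfolding m_def by (intro cInf_lower bdd) auto
  have "\<exists>x. J x < m + inverse (real (Suc n))" for n
    using cInf_lessD[of "range J" "m + inverse (real (Suc n))"] unfolding m_def by auto
  then obtain X where X: "\<And>n. J (X n) < m + inverse (real (Suc n))" by metis
  have par: "(norm (x - y))\<^sup>2 \<le> 2 * (J x - m) + 2 * (J y - m)" for x y
  proof -
    have "(norm (x - y))\<^sup>2 = 2 * J x + 2 * J y - 4 * J ((1/2) *\<^sub>R (x + y))"
      unfolding J_def power2_norm_eq_inner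
      by (simp add: f.add f.scaleR inner_add inner_diff inner_commute algebra_simps)
    thus ?thesis using m[of "(1/2) *\<^sub>R (x + y)"] by simp
  qed
  have "Cauchy X"
  proof (rule metric_CauchyI)
    fix e :: real assume "0 < e"
    hence "0 < e\<^sup>2 / 4" by simp
    then obtain N where N: "inverse (real (Suc N)) < e\<^sup>2 / 4" using reals_Archimedean by blast
    have near: "J (X n) - m < e\<^sup>2 / 4" if "n \<ge> N" for n
    proof -
      have "inverse (real (Suc n)) \<le> inverse (real (Suc N))" using that by (simp add: le_imp_inverse_le)
      thus ?thesis using X[of n] N by linarith
    qed
    show "\<exists>M. \<forall>i\<ge>M. \<forall>n\<ge>M. dist (X i) (X n) < e"
    proof (intro exI allI impI)
      fix i n assume "N \<le> i" "N \<le> n"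
      hence "(norm (X i - X n))\<^sup>2 < e\<^sup>2" using near[of i] near[of n] par[of "X i" "X n"] by simp
      thus "dist (X i) (X n) < e" using \<open>0 < e\<close> by (simp add: dist_norm power_less_imp_less_base)
    qed
  qed
  then obtain z where z: "X \<longlonglongrightarrow> z" using Cauchy_convergent convergent_def by blast
  have "(\<lambda>n. J (X n)) \<longlonglongrightarrow> J z" unfolding J_def by (intro tendsto_intros f.tendsto z)
  moreover have "(\<lambda>n. m + inverse (real (Suc n))) \<longlonglongrightarrow> m + 0"
    by (intro tendsto_intros LIMSEQ_inverse_real_of_nat)
  ultimately have "J z \<le> m + 0" by (rule LIMSEQ_le) (use X in \<open>auto intro: less_imp_le\<close>)
  hence zmin: "J z \<le> J x" for x using m[of x] by simp
  have "f v = z \<bullet> v" for v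
  proof -
    define d where "d = f v - z \<bullet> v"
    have q: "0 \<le> t\<^sup>2 * (v \<bullet> v) - 2 * t * d" for t
      using zmin[of "z + t *\<^sub>R v"] unfolding J_def d_def
      by (simp add: f.add f.scaleR inner_add inner_commute power2_eq_square algebra_simps)
    \<comment> \<open>The quadratic in \<open>t\<close> is negative at this point unless \<open>d = 0\<close>; the summand 1 avoids a
      division by zero.\<close>
    define t where "t = d / (v \<bullet> v + 1)"
    have pos: "v \<bullet> v + 1 > 0" by (simp add: add_nonneg_pos)
    have "d = t * (v \<bullet> v + 1)" using pos by (simp add: t_def)
    hence "t\<^sup>2 * (v \<bullet> v) - 2 * t * d = - (t\<^sup>2 * (v \<bullet> v + 2))"
      by (simp add: power2_eq_square algebra_simps)
    hence "t\<^sup>2 * (v \<bullet> v + 2) \<le> 0" using q[of t] by simp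
    hence "t = 0" by (smt (verit) inner_ge_zero mult_pos_pos zero_less_power2)
    thus ?thesis using \<open>d = t * _\<close> d_def by simp
  qed
  thus ?thesis by (rule that)
qed

lemma inner_eq_all_imp_eq:
  assumes "\<And>z. z \<bullet> x = z \<bullet> (y::'a::real_inner)" shows "x = y"
proof -
  have "(x - y) \<bullet> (x - y) = 0" using assms[of "x - y"] by (simp only: inner_diff_right)
  thus ?thesis by simp
qed

lemma adjoint_exists:
  fixes A :: "'a::chilbert_space \<Rightarrow> 'a"
  assumes A: "bounded_clinear A"
  obtains B where "bounded_clinear B" "\<And>x y. A x \<bullet> y = x \<bullet> B y"
proof -
  interpret A: bounded_linear A using A by (simp add: bounded_clinear_def)
  have "\<exists>z. \<forall>x. A x \<bullet> y = x \<bullet> z" for y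
  proof -
    have "bounded_linear (\<lambda>x. A x \<bullet> y)"
      by (rule bounded_linear_compose[OF bounded_linear_inner_left A.bounded_linear_axioms])
    then obtain z where "\<And>x. A x \<bullet> y = z \<bullet> x" by (rule riesz_representation) metis
    thus ?thesis by (metis inner_commute)
  qed
  then obtain B where B: "\<And>x y. A x \<bullet> y = x \<bullet> B y" by metis
  obtain K where K: "K > 0" "\<And>x. norm (A x) \<le> norm x * K" using A.pos_bounded by blast
  have "bounded_clinear B"
  proof (rule bounded_clinearI)
    show "B (x + y) = B x + B y" for x y
      by (rule inner_eq_all_imp_eq) (simp add: inner_add_right flip: B)
    show "B (c *\<^sub>C x) = c *\<^sub>C B x" for c x
    proof (rule inner_eq_all_imp_eq)
      fix z
      have "z \<bullet> B (c *\<^sub>C x) = A (cnj c *\<^sub>C z) \<bullet> x"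
        by (simp add: B[symmetric] bounded_clinear_scaleC[OF A] inner_scaleC_left)
      also have "\<dots> = z \<bullet> (c *\<^sub>C B x)" by (simp add: B inner_scaleC_left)
      finally show "z \<bullet> B (c *\<^sub>C x) = z \<bullet> (c *\<^sub>C B x)" .
    qed
    show "norm (B x) \<le> K * norm x" for x
    proof -
      have "norm (B x) * norm (B x) = A (B x) \<bullet> x" by (simp add: B norm_eq_square dot_square_norm power2_eq_square)
      also have "\<dots> \<le> norm (A (B x)) * norm x" by (rule norm_cauchy_schwarz)
      also have "\<dots> \<le> (norm (B x) * K) * norm x" by (intro mult_right_mono K) simp
      finally have "norm (B x) * norm (B x) \<le> norm (B x) * (K * norm x)" by (simp add: mult.assoc)
      thus ?thesis
        using K(1) by (cases "norm (B x) = 0") (auto simp: mult_le_cancel_left)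
    qed
  qed
  thus ?thesis using B that by blast
qed

text \<open>The real inner product already determines the adjoint, since a complex-linear map is
  compatible with multiplication by \<open>\<i>\<close>.\<close>

lemma cinner_adjoint_iff:
  assumes "bounded_clinear A" "bounded_clinear B"
  shows "(\<forall>x y. cinner (A x) y = cinner x (B y)) \<longleftrightarrow> (\<forall>x y. A x \<bullet> y = x \<bullet> B y)"
  by (simp add: cinner_eq_inner bounded_clinear_scaleC[OF assms(2), symmetric]) blast

lemma
  fixes A :: "'a::chilbert_space \<Rightarrow> 'a"
  assumes A: "bounded_clinear A"
  shows bounded_clinear_cadjoint: "bounded_clinear (cadjoint A)"
    and cadjoint_inner: "A x \<bullet> y = x \<bullet> cadjoint A y"
    and cadjoint_inner': "cadjoint A x \<bullet> y = x \<bullet> A y"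
    and cinner_cadjoint: "cinner (A x) y = cinner x (cadjoint A y)"
proof -
  let ?P = "\<lambda>B. bounded_clinear B \<and> (\<forall>x y. cinner (A x) y = cinner x (B y))"
  obtain B where B: "bounded_clinear B" "\<And>x y. A x \<bullet> y = x \<bullet> B y"
    using adjoint_exists[OF A] by metis
  have "\<exists>!B. ?P B"
  proof
    show "?P B" using B cinner_adjoint_iff[OF A B(1)] by blast
  next
    fix C assume "?P C"
    hence "\<And>x y. A x \<bullet> y = x \<bullet> C y" using cinner_adjoint_iff[OF A] by blast
    thus "C = B" by (metis B(2) ext inner_eq_all_imp_eq)
  qed
  hence P: "?P (cadjoint A)" unfolding cadjoint_def by (rule theI')
  thus "bounded_clinear (cadjoint A)" "cinner (A x) y = cinner x (cadjoint A y)" by auto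
  have *: "A x \<bullet> y = x \<bullet> cadjoint A y" for x y using P cinner_adjoint_iff[OF A] by blast
  show "A x \<bullet> y = x \<bullet> cadjoint A y" by (rule *)
  show "cadjoint A x \<bullet> y = x \<bullet> A y" by (metis * inner_commute)
qed

lemma cadjoint_eqI:
  assumes "bounded_clinear A" "\<And>x y. A x \<bullet> y = x \<bullet> B y"
  shows "cadjoint A = B"
  by (metis assms cadjoint_inner ext inner_eq_all_imp_eq)

lemma cadjoint_cadjoint: "bounded_clinear A \<Longrightarrow> cadjoint (cadjoint A) = A"
  by (intro cadjoint_eqI bounded_clinear_cadjoint cadjoint_inner')

section \<open>Positive operators and their square roots\<close>

lemma inner_imaginary_skew: "(\<i> *\<^sub>C u) \<bullet> v = - (u \<bullet> (\<i> *\<^sub>C (v::'a::complex_inner)))"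
proof -
  have "cnj \<i> *\<^sub>C v = - (\<i> *\<^sub>C v)"
    using scaleC_of_real[of "-1" "\<i> *\<^sub>C v"] by (simp add: scaleC_scaleC)
  thus ?thesis by (simp add: inner_scaleC_left)
qed

text \<open>Over the complex numbers a real quadratic form forces symmetry: polarise with \<open>x + \<i>y\<close>.\<close>

lemma positive_op_symmetric:
  assumes "positive_op A"
  shows "A x \<bullet> y = x \<bullet> A y"
proof -
  have A: "bounded_clinear A" and real: "\<And>x. Im (cinner (A x) x) = 0"
    using assms by (auto simp: positive_op_def complex_nonneg_Reals_iff)
  have ii: "\<i> *\<^sub>C \<i> *\<^sub>C v = - v" for v :: 'a
    using scaleC_of_real[of "-1" v] by (simp add: scaleC_scaleC)
  have "A u \<bullet> (\<i> *\<^sub>C u) = 0" for u using real[of u] by (simp add: cinner_eq_inner)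
  from this[of "x + \<i> *\<^sub>C y"] this[of x] this[of "\<i> *\<^sub>C y"]
  show ?thesis
    by (simp add: bounded_clinear_add[OF A] bounded_clinear_scaleC[OF A] scaleC_add_right
        inner_add inner_diff ii inner_imaginary_skew scaleC_minus_right inner_commute)
qed

lemma positive_op_nonneg: "positive_op A \<Longrightarrow> 0 \<le> A x \<bullet> x"
  by (auto simp: positive_op_def complex_nonneg_Reals_iff simp flip: Re_cinner)

lemma positive_op_bounded_clinear: "positive_op A \<Longrightarrow> bounded_clinear A"
  by (simp add: positive_op_def)

text \<open>The converse works in terms of the real inner product alone: if \<open>A\<close> is symmetric, then the
  imaginary part \<open>Ax \<bullet> \<i>x\<close> of \<open>\<langle>Ax, x\<rangle>\<close> is equal to its own negative.\<close>

lemma positive_opI: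
  assumes A: "bounded_clinear A" and sym: "\<And>x y. A x \<bullet> y = x \<bullet> A y" and pos: "\<And>x. 0 \<le> A x \<bullet> x"
  shows "positive_op A"
proof -
  have "A x \<bullet> (\<i> *\<^sub>C x) = 0" for x
  proof -
    have "A x \<bullet> (\<i> *\<^sub>C x) = x \<bullet> (\<i> *\<^sub>C A x)" by (simp add: sym bounded_clinear_scaleC[OF A])
    also have "\<dots> = - ((\<i> *\<^sub>C x) \<bullet> A x)" by (simp add: inner_imaginary_skew)
    finally show ?thesis by (simp add: inner_commute)
  qed
  thus ?thesis
    using pos by (simp add: positive_op_def A complex_nonneg_Reals_iff cinner_eq_inner)
qed

lemma positive_op_add:
  assumes "positive_op A" "positive_op B"
  shows "positive_op (\<lambda>x. A x + B x)"
proof (rule positive_opI)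
  show "bounded_clinear (\<lambda>x. A x + B x)"
    by (intro bounded_clinear_sum positive_op_bounded_clinear assms)
  show "(A x + B x) \<bullet> y = x \<bullet> (A y + B y)" for x y
    by (simp add: inner_add assms[THEN positive_op_symmetric])
  show "0 \<le> (A x + B x) \<bullet> x" for x
    by (simp add: inner_add_left assms[THEN positive_op_nonneg])
qed

lemma positive_op_conjugate:
  assumes A: "bounded_clinear A" and P: "positive_op P"
  shows "positive_op (\<lambda>x. cadjoint A (P (A x)))"
proof (rule positive_opI)
  show "bounded_clinear (\<lambda>x. cadjoint A (P (A x)))"
    by (intro A bounded_clinear_compose[OF positive_op_bounded_clinear[OF P]]
        bounded_clinear_compose[OF bounded_clinear_cadjoint[OF A]])
  show "cadjoint A (P (A x)) \<bullet> y = x \<bullet> cadjoint A (P (A y))" for x y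
    by (simp add: cadjoint_inner'[OF A] positive_op_symmetric[OF P] flip: cadjoint_inner[OF A])
  show "0 \<le> cadjoint A (P (A x)) \<bullet> x" for x
    by (simp add: cadjoint_inner'[OF A] positive_op_nonneg[OF P])
qed

text \<open>A form of the Cauchy-Schwarz inequality for \<open>(x, y) \<mapsto> \<langle>Ax, y\<rangle>\<close>: evaluate its quadratic
  form at \<open>cx - Ax\<close>.\<close>

lemma positive_op_norm_square_le:
  assumes A: "positive_op A" and c: "c > 0" "\<And>x. norm (A x) \<le> c * norm x"
  shows "(norm (A x))\<^sup>2 \<le> c * (A x \<bullet> x)"
proof -
  note lin = bounded_clinear_simps[OF positive_op_bounded_clinear[OF A]]
  have "A (A x) \<bullet> A x \<le> norm (A (A x)) * norm (A x)" by (rule norm_cauchy_schwarz)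
  also have "\<dots> \<le> c * norm (A x) * norm (A x)" by (intro mult_right_mono c) simp
  finally have AA: "A (A x) \<bullet> A x \<le> c * (A x \<bullet> A x)"
    by (simp add: dot_square_norm power2_eq_square mult.assoc)
  have "0 \<le> A (c *\<^sub>R x - A x) \<bullet> (c *\<^sub>R x - A x)" by (rule positive_op_nonneg[OF A])
  also have "\<dots> = c * (c * (A x \<bullet> x)) - 2 * (c * (A x \<bullet> A x)) + A (A x) \<bullet> A x"
    using positive_op_symmetric[OF A, of "A x" x]
    by (simp add: lin inner_diff algebra_simps)
  also have "\<dots> \<le> c * (c * (A x \<bullet> x) - A x \<bullet> A x)" using AA by (simp add: algebra_simps)
  finally show ?thesis using c(1) by (simp add: zero_le_mult_iff dot_square_norm)
qed

lemma bounded_clinear_pos_bound: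
  assumes "bounded_clinear A"
  obtains c where "c > 0" "\<And>x. norm (A x) \<le> c * norm x"
  using assms bounded_linear.pos_bounded[of A] unfolding bounded_clinear_def
  by (metis mult.commute)

lemma positive_op_null:
  assumes "positive_op A" "A x \<bullet> x = 0" shows "A x = 0"
proof -
  obtain c where "c > 0" "\<And>x. norm (A x) \<le> c * norm x"
    using bounded_clinear_pos_bound[OF positive_op_bounded_clinear[OF assms(1)]] by metis
  from positive_op_norm_square_le[OF assms(1) this, of x] assms(2) show ?thesis by simp
qed

text \<open>If \<open>\<parallel>B\<parallel> \<le> 1\<close>, then \<open>R = 1 - Y\<close> satisfies \<open>R\<^sup>2 = 1 - B\<close> iff \<open>Y = (B + Y\<^sup>2)/2\<close>, which suggests
  the following iteration.  Its scalar counterpart for \<open>B = 1\<close> dominates it and converges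
  monotonically.\<close>

primrec root_iter :: "('a::real_vector \<Rightarrow> 'a) \<Rightarrow> nat \<Rightarrow> 'a \<Rightarrow> 'a" where
  "root_iter B 0 = (\<lambda>x. 0)"
| "root_iter B (Suc n) = (\<lambda>x. (1/2) *\<^sub>R (B x + root_iter B n (root_iter B n x)))"

primrec root_majorant :: "nat \<Rightarrow> real" where
  "root_majorant 0 = 0"
| "root_majorant (Suc n) = (1 + (root_majorant n)\<^sup>2) / 2"

lemma root_majorant_bounds: "0 \<le> root_majorant n" "root_majorant n \<le> 1"
proof (induction n)
  case (Suc n)
  { case 1 show ?case by simp }
  { case 2 show ?case using power_le_one[OF Suc.IH] by simp }
qed simp_all

lemma root_majorant_convergent: "convergent root_majorant"
proof -
  have "root_majorant n \<le> root_majorant (Suc n)" for n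
    using zero_le_power2[of "1 - root_majorant n"] by (simp add: power2_diff)
  hence "incseq root_majorant" by (rule incseq_SucI)
  thus ?thesis
    using root_majorant_bounds by (metis incseq_convergent convergent_def)
qed

context
  fixes B :: "'a::chilbert_space \<Rightarrow> 'a"
  assumes B: "bounded_clinear B" and B_sym: "\<And>x y. B x \<bullet> y = x \<bullet> B y"
    and B_le: "\<And>x. norm (B x) \<le> norm x"
begin

lemma bounded_clinear_root_iter: "bounded_clinear (root_iter B n)"
proof (induction n)
  case 0
  have "c *\<^sub>C (0::'a) = 0" for c using scaleC_scaleR_commute[of c 0 0] by simp
  thus ?case by (intro bounded_clinearI[where K = 0]) simp_all
next
  case (Suc n)
  show ?case unfolding root_iter.simps
    by (intro bounded_clinear_intros bounded_clinear_compose[OF Suc.IH] Suc.IH B)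
qed

lemma root_iter_commute:
  assumes S: "bounded_clinear S" "\<And>x. S (B x) = B (S x)"
  shows "S (root_iter B n x) = root_iter B n (S x)"
  by (induction n arbitrary: x) (simp_all add: bounded_clinear_simps[OF S(1)] S(2))

lemma root_iter_commute_root_iter:
  "root_iter B m (root_iter B n x) = root_iter B n (root_iter B m x)"
proof (rule root_iter_commute[OF bounded_clinear_root_iter])
  show "root_iter B m (B x) = B (root_iter B m x)" for x
    by (rule root_iter_commute[OF B refl, symmetric])
qed

lemma norm_root_iter_le: "norm (root_iter B n x) \<le> root_majorant n * norm x"
proof (induction n arbitrary: x)
  case (Suc n)
  have "norm (root_iter B n (root_iter B n x)) \<le> root_majorant n * norm (root_iter B n x)"
    by (rule Suc.IH)
  also have "\<dots> \<le> root_majorant n * (root_majorant n * norm x)"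
    by (intro mult_left_mono Suc.IH root_majorant_bounds)
  finally have "norm (B x + root_iter B n (root_iter B n x)) \<le> norm x + (root_majorant n)\<^sup>2 * norm x"
    using B_le[of x] by (intro norm_triangle_le add_mono) (simp_all add: power2_eq_square mult.assoc)
  moreover have "norm (root_iter B (Suc n) x) = norm (B x + root_iter B n (root_iter B n x)) / 2" by simp
  ultimately show ?case by (simp add: field_simps del: root_iter.simps)
qed simp

text \<open>The iterates commute, so \<open>Y\<^sub>n\<^sub>+\<^sub>1\<^sup>2 - Y\<^sub>n\<^sup>2 = (Y\<^sub>n\<^sub>+\<^sub>1 + Y\<^sub>n)(Y\<^sub>n\<^sub>+\<^sub>1 - Y\<^sub>n)\<close>, and the majorant satisfies
  the same identity.\<close>

lemma norm_root_iter_diff_le: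
  "norm (root_iter B (Suc n) x - root_iter B n x) \<le> (root_majorant (Suc n) - root_majorant n) * norm x"
proof (induction n arbitrary: x)
  case 0 show ?case using B_le[of x] by simp
next
  case (Suc n)
  let ?Y = "root_iter B" and ?s = root_majorant
  define d where "d = ?Y (Suc n) x - ?Y n x"
  have bound: "norm (?Y k d) \<le> ?s k * ((?s (Suc n) - ?s n) * norm x)" for k
    using norm_root_iter_le[of k d] mult_left_mono[OF Suc.IH[of x, folded d_def] root_majorant_bounds(1)[of k]]
    by linarith
  have "?Y (Suc (Suc n)) x - ?Y (Suc n) x = (1/2) *\<^sub>R (?Y (Suc n) (?Y (Suc n) x) - ?Y n (?Y n x))"
    unfolding root_iter.simps(2)[of B "Suc n"] root_iter.simps(2)[of B n]
    by (simp add: algebra_simps)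
  also have "\<dots> = (1/2) *\<^sub>R (?Y (Suc n) d + ?Y n d)"
    unfolding d_def bounded_clinear_diff[OF bounded_clinear_root_iter]
    by (simp add: root_iter_commute_root_iter[of n "Suc n"] del: root_iter.simps)
  finally have "norm (?Y (Suc (Suc n)) x - ?Y (Suc n) x) = norm (?Y (Suc n) d + ?Y n d) / 2" by simp
  also have "\<dots> \<le> (?s (Suc n) + ?s n) * ((?s (Suc n) - ?s n) * norm x) / 2"
    using norm_triangle_ineq[of "?Y (Suc n) d" "?Y n d"] bound[of "Suc n"] bound[of n]
    by (simp add: algebra_simps del: root_iter.simps root_majorant.simps)
  also have "\<dots> = (?s (Suc (Suc n)) - ?s (Suc n)) * norm x"
    unfolding root_majorant.simps(2)[of "Suc n"] root_majorant.simps(2)[of n]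
    by (simp add: power2_eq_square field_simps)
  finally show ?case .
qed

lemma root_iter_convergent: "convergent (\<lambda>n. root_iter B n x)"
proof -
  have "summable (\<lambda>n. root_majorant (Suc n) - root_majorant n)"
    using root_majorant_convergent unfolding convergent_def by (metis telescope_summable)
  hence "summable (\<lambda>n. (root_majorant (Suc n) - root_majorant n) * norm x)"
    by (rule summable_mult2)
  hence "summable (\<lambda>n. root_iter B (Suc n) x - root_iter B n x)"
    by (rule summable_comparison_test'[where N = 0]) (rule norm_root_iter_diff_le)
  hence "convergent (\<lambda>n. \<Sum>i<n. root_iter B (Suc i) x - root_iter B i x)"
    by (simp add: summable_iff_convergent)
  thus ?thesis unfolding sum_lessThan_telescope[of "\<lambda>n. root_iter B n x"] root_iter.simps(1) by simp
qed

text \<open>The pointwise limit suffices: the iterates are contractions, so composition is continuous along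
  the sequence, and the limit inherits symmetry and commutation.\<close>

lemma root_iter_limit:
  obtains Y where "bounded_clinear Y" "\<And>x. norm (Y x) \<le> norm x"
    "\<And>x. 2 *\<^sub>R Y x = B x + Y (Y x)"
    "\<And>x y. Y x \<bullet> y = x \<bullet> Y y"
    "\<And>S x. bounded_clinear S \<Longrightarrow> (\<And>x. S (B x) = B (S x)) \<Longrightarrow> S (Y x) = Y (S x)"
proof -
  define Y where "Y x = lim (\<lambda>n. root_iter B n x)" for x
  have lim: "(\<lambda>n. root_iter B n x) \<longlonglongrightarrow> Y x" for x
    unfolding Y_def using root_iter_convergent by (simp add: convergent_LIMSEQ_iff)
  have le: "norm (root_iter B n x) \<le> norm x" for n x
    using norm_root_iter_le[of n x] mult_right_mono[OF root_majorant_bounds(2)[of n] norm_ge_zero[of x]]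
    by simp
  have Y_le: "norm (Y x) \<le> norm x" for x
    by (rule LIMSEQ_le_const2[OF tendsto_norm[OF lim]]) (use le in auto)
  have comm: "S (Y x) = Y (S x)" if S: "bounded_clinear S" "\<And>x. S (B x) = B (S x)" for S x
  proof -
    have "(\<lambda>n. S (root_iter B n x)) \<longlonglongrightarrow> S (Y x)"
      using bounded_linear.tendsto[of S, OF _ lim] S(1) by (simp add: bounded_clinear_def)
    thus ?thesis using lim[of "S x"] unfolding root_iter_commute[OF S] by (rule LIMSEQ_unique)
  qed
  have YC: "bounded_clinear Y"
  proof (rule bounded_clinearI)
    show "Y (x + y) = Y x + Y y" for x y
      using tendsto_add[OF lim[of x] lim[of y]] lim[of "x + y"]
      unfolding bounded_clinear_add[OF bounded_clinear_root_iter] by (rule LIMSEQ_unique[symmetric])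
    show "Y (c *\<^sub>C x) = c *\<^sub>C Y x" for c x
    proof (rule comm[symmetric])
      have "c *\<^sub>C d *\<^sub>C x = d *\<^sub>C c *\<^sub>C x" for d and x :: 'a
        by (simp add: scaleC_scaleC mult.commute)
      thus "bounded_clinear (\<lambda>x::'a. c *\<^sub>C x)"
        by (intro bounded_clinearI[where K = "cmod c"]) (simp_all add: scaleC_add_right norm_scaleC)
      show "c *\<^sub>C B x = B (c *\<^sub>C x)" for x by (simp add: bounded_clinear_scaleC[OF B])
    qed
    show "norm (Y x) \<le> 1 * norm x" for x using Y_le by simp
  qed
  have fixpoint: "2 *\<^sub>R Y x = B x + Y (Y x)" for x
  proof -
    have "(\<lambda>n. root_iter B n (root_iter B n x - Y x)) \<longlonglongrightarrow> 0"
    proof (rule Lim_null_comparison)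
      show "\<forall>\<^sub>F n in sequentially.
          norm (root_iter B n (root_iter B n x - Y x)) \<le> norm (root_iter B n x - Y x)"
        by (simp add: le)
      show "(\<lambda>n. norm (root_iter B n x - Y x)) \<longlonglongrightarrow> 0"
        using lim[of x] by (intro tendsto_norm_zero LIM_zero)
    qed
    hence "(\<lambda>n. root_iter B n (root_iter B n x - Y x) + root_iter B n (Y x)) \<longlonglongrightarrow> 0 + Y (Y x)"
      by (intro tendsto_add lim)
    hence "(\<lambda>n. root_iter B n (root_iter B n x)) \<longlonglongrightarrow> Y (Y x)"
      by (simp add: bounded_clinear_diff[OF bounded_clinear_root_iter])
    hence "(\<lambda>n. root_iter B (Suc n) x) \<longlonglongrightarrow> (1/2) *\<^sub>R (B x + Y (Y x))"
      unfolding root_iter.simps by (intro tendsto_intros)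
    moreover have "(\<lambda>n. root_iter B (Suc n) x) \<longlonglongrightarrow> Y x" using lim by (rule LIMSEQ_Suc)
    ultimately have "Y x = (1/2) *\<^sub>R (B x + Y (Y x))" using LIMSEQ_unique by blast
    hence "2 *\<^sub>R Y x = 2 *\<^sub>R ((1/2) *\<^sub>R (B x + Y (Y x)))" by (rule arg_cong)
    thus ?thesis by simp
  qed
  have sym: "Y x \<bullet> y = x \<bullet> Y y" for x y
  proof -
    have s: "root_iter B n x \<bullet> y = x \<bullet> root_iter B n y" for n x y
      by (induction n arbitrary: x y) (simp_all add: inner_add B_sym)
    have "(\<lambda>n. root_iter B n x \<bullet> y) \<longlonglongrightarrow> Y x \<bullet> y" by (intro tendsto_intros lim)
    moreover have "(\<lambda>n. root_iter B n x \<bullet> y) \<longlonglongrightarrow> x \<bullet> Y y" unfolding s by (intro tendsto_intros lim)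
    ultimately show ?thesis by (rule LIMSEQ_unique)
  qed
  show ?thesis by (rule that[OF YC Y_le fixpoint sym comm])
qed

end

text \<open>After scaling to \<open>\<parallel>A\<parallel> \<le> 1\<close>, the operator \<open>B = 1 - A\<close> is a contraction: expand \<open>\<parallel>Bx\<parallel>\<^sup>2\<close> and use
  \<open>\<parallel>Ax\<parallel>\<^sup>2 \<le> \<langle>Ax, x\<rangle>\<close>.  The root \<open>1 - Y\<close> is positive because \<open>\<parallel>Y\<parallel> \<le> 1\<close>.\<close>

lemma positive_op_sqrt_exists:
  assumes A: "positive_op A"
  obtains R where "positive_op R" "\<And>x. R (R x) = A x"
    "\<And>S x. bounded_clinear S \<Longrightarrow> (\<And>x. S (A x) = A (S x)) \<Longrightarrow> S (R x) = R (S x)"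
proof -
  note AC = positive_op_bounded_clinear[OF A]
  obtain c where c: "c > 0" and bound: "\<And>x. norm (A x) \<le> c * norm x"
    using bounded_clinear_pos_bound[OF AC] by metis
  define B where "B x = x - inverse c *\<^sub>R A x" for x
  have B: "bounded_clinear B" unfolding B_def by (intro bounded_clinear_intros AC)
  have B_le: "norm (B x) \<le> norm x" for x
  proof -
    have "(norm (B x))\<^sup>2 = (norm x)\<^sup>2 - (2 * inverse c * (A x \<bullet> x) - (inverse c)\<^sup>2 * (norm (A x))\<^sup>2)"
      unfolding B_def power2_norm_eq_inner
      by (simp add: inner_diff inner_commute power2_eq_square algebra_simps)
    moreover have "(inverse c)\<^sup>2 * (norm (A x))\<^sup>2 \<le> (inverse c)\<^sup>2 * (c * (A x \<bullet> x))"
      by (intro mult_left_mono positive_op_norm_square_le[OF A c bound]) simp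
    moreover have "(inverse c)\<^sup>2 * (c * (A x \<bullet> x)) = inverse c * (A x \<bullet> x)"
      using c by (simp add: power2_eq_square)
    moreover have "0 \<le> inverse c * (A x \<bullet> x)" using c positive_op_nonneg[OF A] by simp
    ultimately have "(norm (B x))\<^sup>2 \<le> (norm x)\<^sup>2" by linarith
    thus ?thesis by (rule power2_le_imp_le) simp
  qed
  have B_sym: "B x \<bullet> y = x \<bullet> B y" for x y
    by (simp add: B_def inner_diff positive_op_symmetric[OF A])
  obtain Y where Y: "bounded_clinear Y" and Y_le: "\<And>x. norm (Y x) \<le> norm x"
    and fixpoint: "\<And>x. 2 *\<^sub>R Y x = B x + Y (Y x)"
    and sym: "\<And>x y. Y x \<bullet> y = x \<bullet> Y y"
    and comm: "\<And>S x. bounded_clinear S \<Longrightarrow> (\<And>x. S (B x) = B (S x)) \<Longrightarrow> S (Y x) = Y (S x)"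
    using root_iter_limit[OF B B_sym B_le] by blast
  define R where "R x = sqrt c *\<^sub>R (x - Y x)" for x
  have RC: "bounded_clinear R" unfolding R_def by (intro bounded_clinear_intros Y)
  have "positive_op R"
  proof (rule positive_opI[OF RC])
    show "R x \<bullet> y = x \<bullet> R y" for x y by (simp add: R_def inner_diff sym)
    show "0 \<le> R x \<bullet> x" for x
    proof -
      have "Y x \<bullet> x \<le> norm (Y x) * norm x" by (rule norm_cauchy_schwarz)
      also have "\<dots> \<le> norm x * norm x" by (intro mult_right_mono Y_le) simp
      finally have "Y x \<bullet> x \<le> x \<bullet> x" by (simp add: dot_square_norm power2_eq_square)
      thus ?thesis using c by (simp add: R_def inner_diff)
    qed
  qed
  moreover have "R (R x) = A x" for x
  proof -
    have "R (R x) = (sqrt c * sqrt c) *\<^sub>R ((x - Y x) - (Y x - Y (Y x)))"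
      by (simp only: R_def bounded_clinear_simps[OF Y] scaleR_diff_right scaleR_scaleR)
    also have "sqrt c * sqrt c = c" using c by simp
    also have "(x - Y x) - (Y x - Y (Y x)) = x - B x"
      using fixpoint[of x] by (simp add: scaleR_2 algebra_simps)
    finally show ?thesis using c by (simp add: B_def)
  qed
  moreover have "S (R x) = R (S x)" if S: "bounded_clinear S" "\<And>x. S (A x) = A (S x)" for S x
    using comm[OF S(1), of x] by (simp add: B_def R_def bounded_clinear_simps[OF S(1)] S(2))
  ultimately show ?thesis by (rule that)
qed

text \<open>A second root \<open>S\<close> commutes with \<open>S\<^sup>2 = A\<close>, hence with the root \<open>R\<close> constructed above.  So
  \<open>(R + S)(R - S) = 0\<close>, and positivity forces \<open>R\<close> and \<open>S\<close> both to vanish on the range of \<open>R - S\<close>.\<close>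

lemma positive_op_sqrt_unique:
  assumes "positive_op S" "positive_op S'" "\<And>x. S (S x) = S' (S' x)"
  shows "S = S'"
proof -
  have SC: "bounded_clinear S" by (rule positive_op_bounded_clinear[OF assms(1)])
  have SS: "positive_op (\<lambda>x. S (S x))"
  proof (rule positive_opI[OF bounded_clinear_compose[OF SC SC]])
    show "S (S x) \<bullet> y = x \<bullet> S (S y)" for x y by (simp add: positive_op_symmetric[OF assms(1)])
    show "0 \<le> S (S x) \<bullet> x" for x by (simp add: positive_op_symmetric[OF assms(1), of "S x"])
  qed
  obtain R where R: "positive_op R" "\<And>x. R (R x) = S (S x)"
    and comm: "\<And>C x. bounded_clinear C \<Longrightarrow> (\<And>x. C (S (S x)) = S (S (C x))) \<Longrightarrow> C (R x) = R (C x)"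
    using positive_op_sqrt_exists[OF SS] by blast
  have "C = R" if C: "positive_op C" and CC: "\<And>x. C (C x) = S (S x)" for C
  proof
    fix x
    note Clin = bounded_clinear_simps[OF positive_op_bounded_clinear[OF C]]
      and Rlin = bounded_clinear_simps[OF positive_op_bounded_clinear[OF R(1)]]
    have cr: "C (R x) = R (C x)" for x
      by (rule comm[OF positive_op_bounded_clinear[OF C]]) (simp flip: CC)
    define y where "y = R x - C x"
    have "R y + C y = 0" by (simp add: y_def Clin Rlin cr R(2) CC)
    hence "R y \<bullet> y + C y \<bullet> y = 0" by (metis inner_add_left inner_zero_left)
    hence "R y \<bullet> y = 0" "C y \<bullet> y = 0"
      using positive_op_nonneg[OF R(1), of y] positive_op_nonneg[OF C, of y] by linarith+
    hence "R y = 0" "C y = 0" using positive_op_null R(1) C by blast+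
    hence "y \<bullet> y = 0"
      using positive_op_symmetric[OF R(1), of x y] positive_op_symmetric[OF C, of x y]
      by (subst (1) y_def) (simp add: inner_diff)
    thus "C x = R x" by (simp add: y_def)
  qed
  thus ?thesis using assms by metis
qed

lemma op_sqrt_eqI:
  assumes "positive_op R" "\<And>x. R (R x) = A x"
  shows "op_sqrt A = R"
  unfolding op_sqrt_def
proof (rule the_equality)
  show "positive_op R \<and> R \<circ> R = A" using assms by (simp add: fun_eq_iff)
  fix S assume "positive_op S \<and> S \<circ> S = A"
  thus "S = R" using assms by (intro positive_op_sqrt_unique) (auto simp: fun_eq_iff)
qed

lemma
  assumes A: "bounded_clinear A"
  shows positive_op_abs: "positive_op (op_abs A)"
    and op_abs_square: "op_abs A (op_abs A x) = cadjoint A (A x)"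
proof -
  have AA: "positive_op (\<lambda>x. cadjoint A (A x))"
    by (rule positive_op_conjugate[OF A, of "\<lambda>x. x"])
      (simp add: positive_opI bounded_clinear_ident)
  obtain R where R: "positive_op R" "\<And>x. R (R x) = cadjoint A (A x)"
    by (rule positive_op_sqrt_exists[OF AA]) (rule that)
  hence "op_abs A = R" unfolding op_abs_def by (intro op_sqrt_eqI) auto
  thus "positive_op (op_abs A)" "op_abs A (op_abs A x) = cadjoint A (A x)" using R by auto
qed

section \<open>Partial isometries and polar decompositions\<close>

text \<open>The range of \<open>W\<^sup>*\<close> is orthogonal to \<open>ker W\<close>, so \<open>\<parallel>WW\<^sup>*y\<parallel> = \<parallel>W\<^sup>*y\<parallel>\<close>; hence \<open>E = WW\<^sup>*\<close> satisfies
  \<open>E\<^sup>2 = E\<close>, and \<open>\<parallel>W\<^sup>*(Ey - y)\<parallel>\<^sup>2 = \<langle>E(Ey - y), Ey - y\<rangle> = 0\<close>.\<close>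

lemma partial_isometry_cadjoint_absorb:
  fixes W :: "'a::chilbert_space \<Rightarrow> 'a"
  assumes "partial_isometry W"
  shows "cadjoint W (W (cadjoint W y)) = cadjoint W y"
proof -
  have W: "bounded_clinear W" using assms by (simp add: partial_isometry_def)
  let ?W' = "cadjoint W"
  note W' = bounded_clinear_cadjoint[OF W]
  define F where "F x = W (?W' (W (?W' x))) - W (?W' x)" for x
  have F: "bounded_clinear F" unfolding F_def
    by (intro bounded_clinear_intros bounded_clinear_compose[OF W] bounded_clinear_compose[OF W'] W')
  have iso: "norm (W (?W' x)) = norm (?W' x)" for x
  proof -
    have "\<forall>y\<in>ker W. cinner (?W' x) y = 0"
    proof
      fix y assume "y \<in> ker W"
      have "cinner y (?W' x) = cinner (W y) x" by (simp add: cinner_cadjoint[OF W])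
      also have "\<dots> = 0" using \<open>y \<in> ker W\<close> by (simp add: ker_def cinner_eq_inner complex_eq_iff)
      finally show "cinner (?W' x) y = 0" by (subst cinner_commute) simp
    qed
    thus ?thesis using assms by (simp add: partial_isometry_def)
  qed
  have sym: "F x \<bullet> z = x \<bullet> F z" for x z
    by (simp add: F_def inner_diff cadjoint_inner[OF W] cadjoint_inner'[OF W])
  have quad: "F x \<bullet> x = 0" for x
    using iso[of x] by (simp add: F_def inner_diff cadjoint_inner[OF W] cadjoint_inner'[OF W] norm_eq_sqrt_inner)
  have "positive_op F" using sym quad by (intro positive_opI F) auto
  hence F0: "F x = 0" for x using quad by (rule positive_op_null)
  have E: "W (?W' (W (?W' x))) = W (?W' x)" for x using F0[of x] by (simp add: F_def)
  define d where "d = W (?W' y) - y"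
  have "W (?W' d) = 0"
    by (simp add: d_def bounded_clinear_simps[OF W] bounded_clinear_simps[OF W'] E)
  hence "?W' d \<bullet> ?W' d = 0" by (simp add: cadjoint_inner'[OF W])
  thus ?thesis by (simp add: d_def bounded_clinear_simps[OF W'])
qed

lemma partial_isometry_absorb:
  fixes W :: "'a::chilbert_space \<Rightarrow> 'a"
  assumes "partial_isometry W"
  shows "W (cadjoint W (W x)) = W x"
proof (rule inner_eq_all_imp_eq)
  fix z
  have W: "bounded_clinear W" using assms by (simp add: partial_isometry_def)
  show "z \<bullet> W (cadjoint W (W x)) = z \<bullet> W x"
    using partial_isometry_cadjoint_absorb[OF assms, of z]
    by (simp flip: cadjoint_inner[OF W] cadjoint_inner'[OF W])
qed

text \<open>On the orthogonal complement of \<open>ker W\<^sup>*\<close>, the map \<open>WW\<^sup>*\<close> is the identity in the weak sense that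
  \<open>\<langle>x - WW\<^sup>*x, x\<rangle> = 0\<close>, since \<open>x - WW\<^sup>*x\<close> lies in \<open>ker W\<^sup>*\<close>.\<close>

lemma partial_isometry_cadjoint:
  fixes W :: "'a::chilbert_space \<Rightarrow> 'a"
  assumes "partial_isometry W"
  shows "partial_isometry (cadjoint W)"
  unfolding partial_isometry_def
proof (intro conjI allI impI)
  have W: "bounded_clinear W" using assms by (simp add: partial_isometry_def)
  show W': "bounded_clinear (cadjoint W)" by (rule bounded_clinear_cadjoint[OF W])
  fix x assume orth: "\<forall>y\<in>ker (cadjoint W). cinner x y = 0"
  have "x - W (cadjoint W x) \<in> ker (cadjoint W)"
    by (simp add: ker_def bounded_clinear_simps[OF W'] partial_isometry_cadjoint_absorb[OF assms])
  hence "x \<bullet> (x - W (cadjoint W x)) = 0" using orth by (metis Re_cinner zero_complex.simps(1))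
  thus "norm (cadjoint W x) = norm x"
    by (simp add: inner_diff norm_eq_sqrt_inner cadjoint_inner'[OF W])
qed

lemma ker_op_abs:
  assumes A: "bounded_clinear A"
  shows "ker (op_abs A) = ker A"
proof -
  have "op_abs A x \<bullet> op_abs A x = A x \<bullet> A x" for x
    by (simp add: positive_op_symmetric[OF positive_op_abs[OF A]] op_abs_square[OF A] cadjoint_inner[OF A])
  hence "op_abs A x = 0 \<longleftrightarrow> A x = 0" for x by (metis inner_eq_zero_iff)
  thus ?thesis by (simp add: ker_def)
qed

text \<open>If \<open>D = W - W'\<close>, then \<open>D|A| = 0\<close>, so \<open>|A|D\<^sup>* = 0\<close> and \<open>D\<^sup>*\<close> maps into \<open>ker A\<close>, where \<open>D\<close>
  vanishes.  Thus \<open>DD\<^sup>* = 0\<close>.\<close>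

lemma polar_decomposition_unique:
  assumes A: "bounded_clinear A" and "polar_decomposition A W" "polar_decomposition A W'"
  shows "W = W'"
proof
  fix x
  have W: "bounded_clinear W" "bounded_clinear W'"
    and eq: "A = W \<circ> op_abs A" "A = W' \<circ> op_abs A" and ker: "ker W = ker A" "ker W' = ker A"
    using assms(2,3) by (auto simp: polar_decomposition_def partial_isometry_def)
  define D where "D x = W x - W' x" for x
  have D: "bounded_clinear D" unfolding D_def by (intro bounded_clinear_intros W)
  have "op_abs A (cadjoint D y) = 0" for y
  proof (rule inner_eq_all_imp_eq)
    fix z
    have "D (op_abs A z) = 0" using eq by (simp add: D_def fun_eq_iff)
    thus "z \<bullet> op_abs A (cadjoint D y) = z \<bullet> 0"
      using cadjoint_inner[OF D, of "op_abs A z" y] by (simp add: positive_op_symmetric[OF positive_op_abs[OF A]])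
  qed
  hence "cadjoint D y \<in> ker A" for y unfolding ker_op_abs[OF A, symmetric] by (simp add: ker_def)
  hence "D (cadjoint D y) = 0" for y
    using ker unfolding D_def[of "cadjoint D y"] by (metis (mono_tags) diff_zero ker_def mem_Collect_eq)
  hence "cadjoint D y \<bullet> cadjoint D y = 0" for y by (simp add: cadjoint_inner'[OF D])
  hence "D x \<bullet> D x = 0" by (simp add: cadjoint_inner[OF D])
  thus "W x = W' x" by (simp add: D_def)
qed

lemma mean_transform_eq:
  assumes "bounded_clinear A" "polar_decomposition A W"
  shows "mean_transform A = (\<lambda>x. (1/2) *\<^sub>R (A x + op_abs A (W x)))"
proof -
  have "(THE W. polar_decomposition A W) = W"
    using assms by (intro the_equality) (auto intro: polar_decomposition_unique)
  thus ?thesis by (simp add: mean_transform_def)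
qed

context
  fixes T V :: "'a::chilbert_space \<Rightarrow> 'a"
  assumes T: "bounded_clinear T" and polar: "polar_decomposition T V"
begin

lemma polar_decomposition_factor_bounded_clinear: "bounded_clinear V"
  using polar by (simp add: polar_decomposition_def partial_isometry_def)

lemma polar_decomposition_eq: "T x = V (op_abs T x)"
  using polar by (metis comp_apply polar_decomposition_def)

lemma cadjoint_polar_decomposition: "cadjoint T = op_abs T \<circ> cadjoint V"
  by (rule cadjoint_eqI[OF T])
    (simp add: polar_decomposition_eq cadjoint_inner[OF polar_decomposition_factor_bounded_clinear]
      positive_op_symmetric[OF positive_op_abs[OF T]])

text \<open>\<open>V\<^sup>*Vy - y\<close> lies in \<open>ker V = ker |T|\<close>, so \<open>|T|V\<^sup>*V = |T|\<close>; take adjoints.\<close>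

lemma polar_decomposition_initial_projection: "cadjoint V (V (op_abs T x)) = op_abs T x"
proof -
  note V = polar_decomposition_factor_bounded_clinear
  note P = positive_op_abs[OF T]
  have absorb: "op_abs T (cadjoint V (V y)) = op_abs T y" for y
  proof -
    have "V (cadjoint V (V y) - y) = 0"
      using partial_isometry_absorb[of V y] polar
      by (simp add: bounded_clinear_simps[OF V] polar_decomposition_def)
    hence "cadjoint V (V y) - y \<in> ker (op_abs T)"
      using polar by (simp add: polar_decomposition_def ker_op_abs[OF T]) (auto simp: ker_def)
    thus ?thesis by (simp add: ker_def bounded_clinear_simps[OF positive_op_bounded_clinear[OF P]])
  qed
  show ?thesis
    by (rule inner_eq_all_imp_eq)
      (simp add: absorb flip: cadjoint_inner[OF V] cadjoint_inner'[OF V] positive_op_symmetric[OF P])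
qed

text \<open>\<open>(V|T|V\<^sup>*)\<^sup>2 = V|T|\<^sup>2V\<^sup>* = TT\<^sup>*\<close>, and positive square roots are unique.\<close>

lemma op_abs_cadjoint: "op_abs (cadjoint T) = V \<circ> op_abs T \<circ> cadjoint V"
  unfolding op_abs_def[of "cadjoint T"]
proof (rule op_sqrt_eqI)
  note V = polar_decomposition_factor_bounded_clinear
  note P = positive_op_abs[OF T]
  show "positive_op (V \<circ> op_abs T \<circ> cadjoint V)"
    using positive_op_conjugate[OF bounded_clinear_cadjoint[OF V] P]
    by (simp add: cadjoint_cadjoint[OF V] comp_def)
  show "(V \<circ> op_abs T \<circ> cadjoint V) ((V \<circ> op_abs T \<circ> cadjoint V) x) = (cadjoint (cadjoint T) \<circ> cadjoint T) x" for x
    by (simp add: cadjoint_cadjoint[OF T] polar_decomposition_initial_projection)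
      (simp add: cadjoint_polar_decomposition polar_decomposition_eq)
qed

lemma ker_cadjoint_polar: "ker (cadjoint V) = ker (cadjoint T)"
proof -
  note V = polar_decomposition_factor_bounded_clinear
  have "cadjoint V y = 0" if "cadjoint T y = 0" for y
  proof -
    have "cadjoint V y \<in> ker (op_abs T)" using that by (simp add: cadjoint_polar_decomposition ker_def)
    hence "V (cadjoint V y) = 0"
      using polar by (simp add: ker_op_abs[OF T] polar_decomposition_def) (auto simp: ker_def)
    hence "cadjoint V y \<bullet> cadjoint V y = 0" by (simp add: cadjoint_inner'[OF V])
    thus ?thesis by simp
  qed
  thus ?thesis
    by (auto simp: ker_def cadjoint_polar_decomposition
        bounded_clinear_zero[OF positive_op_bounded_clinear[OF positive_op_abs[OF T]]])
qed

lemma polar_decomposition_cadjoint: "polar_decomposition (cadjoint T) (cadjoint V)"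
  unfolding polar_decomposition_def
proof (intro conjI)
  show "partial_isometry (cadjoint V)"
    using polar by (simp add: partial_isometry_cadjoint polar_decomposition_def)
  show "cadjoint T = cadjoint V \<circ> op_abs (cadjoint T)"
    unfolding op_abs_cadjoint
    by (simp add: fun_eq_iff polar_decomposition_initial_projection cadjoint_polar_decomposition)
  show "ker (cadjoint V) = ker (cadjoint T)" by (rule ker_cadjoint_polar)
qed

end

text \<open>Both products are symmetric idempotents, and such a map is determined by its kernel.\<close>

lemma partial_isometry_normal:
  fixes V :: "'a::chilbert_space \<Rightarrow> 'a"
  assumes piso: "partial_isometry V" and ker: "ker V = ker (cadjoint V)"
  shows "V (cadjoint V x) = cadjoint V (V x)"
proof -
  have V: "bounded_clinear V" using piso by (simp add: partial_isometry_def)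
  note V' = bounded_clinear_cadjoint[OF V]
  have null: "V y = 0 \<longleftrightarrow> cadjoint V y = 0" for y using ker by (auto simp: ker_def)
  have "cadjoint V (y - cadjoint V (V y)) = 0" for y
    unfolding null[symmetric] by (simp add: bounded_clinear_simps[OF V] partial_isometry_absorb[OF piso])
  hence 1: "cadjoint V y = cadjoint V (cadjoint V (V y))" for y
    by (simp add: bounded_clinear_simps[OF V'])
  have "V (y - V (cadjoint V y)) = 0" for y
    unfolding null by (simp add: bounded_clinear_simps[OF V'] partial_isometry_cadjoint_absorb[OF piso])
  hence 2: "V y = V (V (cadjoint V y))" for y by (simp add: bounded_clinear_simps[OF V])
  show ?thesis
  proof (rule inner_eq_all_imp_eq)
    fix z
    have "z \<bullet> V (cadjoint V x) = V (cadjoint V z) \<bullet> x"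
      by (simp add: cadjoint_inner[OF V] cadjoint_inner'[OF V])
    also have "\<dots> = V (cadjoint V (cadjoint V (V z))) \<bullet> x" by (simp flip: 1)
    also have "\<dots> = z \<bullet> cadjoint V (V (V (cadjoint V x)))"
      by (simp add: cadjoint_inner[OF V] cadjoint_inner'[OF V])
    also have "\<dots> = z \<bullet> cadjoint V (V x)" by (simp flip: 2)
    finally show "z \<bullet> V (cadjoint V x) = z \<bullet> cadjoint V (V x)" .
  qed
qed

section \<open>Normality of the mean transform\<close>

theorem theorem4p2:
  fixes T V :: "'a::chilbert_space \<Rightarrow> 'a"
  assumes "bounded_clinear T"
    and "polar_decomposition T V"
    and "ker T = ker (cadjoint T)"
  shows "(normal_op (mean_transform T)
            \<longleftrightarrow> cadjoint V \<circ> op_abs T \<circ> V = V \<circ> op_abs T \<circ> cadjoint V)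
       \<and> (cadjoint V \<circ> op_abs T \<circ> V = V \<circ> op_abs T \<circ> cadjoint V
            \<longleftrightarrow> V \<circ> V \<circ> op_abs T = op_abs T \<circ> V \<circ> V)
       \<and> (V \<circ> V \<circ> op_abs T = op_abs T \<circ> V \<circ> V
            \<longleftrightarrow> mean_transform (cadjoint T) = cadjoint (mean_transform T))"
proof -
  note T = assms(1) and polar = assms(2)
  define P where "P = op_abs T"
  define W where "W = cadjoint V"
  have V: "bounded_clinear V" by (rule polar_decomposition_factor_bounded_clinear[OF T polar])
  have piso: "partial_isometry V" using polar by (simp add: polar_decomposition_def)
  have W: "bounded_clinear W" unfolding W_def by (rule bounded_clinear_cadjoint[OF V])
  have Ppos: "positive_op P" unfolding P_def by (rule positive_op_abs[OF T])
  have PC: "bounded_clinear P" by (rule positive_op_bounded_clinear[OF Ppos])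
  note comp = V[THEN bounded_clinear_compose] W[THEN bounded_clinear_compose]
    PC[THEN bounded_clinear_compose]
  note lin = bounded_clinear_simps[OF V] bounded_clinear_simps[OF W] bounded_clinear_simps[OF PC]
  have adj: "V x \<bullet> y = x \<bullet> W y" "W x \<bullet> y = x \<bullet> V y" "P x \<bullet> y = x \<bullet> P y" for x y
    using cadjoint_inner[OF V] cadjoint_inner'[OF V] positive_op_symmetric[OF Ppos]
    by (auto simp: W_def)
  have Tx: "T x = V (P x)" for x unfolding P_def by (rule polar_decomposition_eq[OF T polar])
  have VW: "V (W x) = W (V x)" for x
    unfolding W_def
    by (rule partial_isometry_normal[OF piso])
      (use polar assms(3) in \<open>simp add: ker_cadjoint_polar[OF T polar] polar_decomposition_def\<close>)
  have WVV: "W (V (V x)) = V x" for x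
    using partial_isometry_absorb[OF piso, of x] by (simp add: W_def[symmetric] VW)
  have WWV: "W (W (V x)) = W x" for x
    using partial_isometry_cadjoint_absorb[OF piso, of x] by (simp add: W_def[symmetric] VW)
  have WVP: "W (V (P x)) = P x" for x
    unfolding W_def P_def by (rule polar_decomposition_initial_projection[OF T polar])
  have PWV: "P (W (V x)) = P x" for x
    by (rule inner_eq_all_imp_eq) (simp add: WVP flip: adj)
  \<comment> \<open>As rewrite rules, these bring every word in \<open>V\<close>, \<open>W\<close> and \<open>P\<close> below to a normal form.\<close>
  note red = VW WVV WWV WVP PWV
  define N where "N x = (1/2) *\<^sub>R (V (P x) + P (V x))" for x
  define N' where "N' x = (1/2) *\<^sub>R (P (W x) + W (P x))" for x
  have M: "mean_transform T = N"
    unfolding mean_transform_eq[OF T polar] N_def[abs_def] by (simp add: Tx P_def[symmetric])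
  have N: "bounded_clinear N" unfolding N_def by (intro bounded_clinear_intros comp)
  have N': "cadjoint N = N'"
    by (rule cadjoint_eqI[OF N]) (simp add: N_def N'_def inner_add adj)
  have M': "mean_transform (cadjoint T) = (\<lambda>x. (1/2) *\<^sub>R (P (W x) + V (P (W (W x)))))"
    unfolding mean_transform_eq[OF bounded_clinear_cadjoint[OF T] polar_decomposition_cadjoint[OF T polar]]
      op_abs_cadjoint[OF T polar]
    by (simp add: cadjoint_polar_decomposition[OF T polar] P_def W_def)

  define R where "R x = V (P (W x)) + P x" for x
  define S where "S x = W (P (V x)) + P x" for x
  have R: "positive_op R"
    unfolding R_def using positive_op_conjugate[OF W Ppos]
    by (intro positive_op_add Ppos) (simp add: W_def cadjoint_cadjoint[OF V])
  have S: "positive_op S"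
    unfolding S_def using positive_op_conjugate[OF V Ppos]
    by (intro positive_op_add Ppos) (simp add: W_def)
  have NN': "N (N' x) = (1/4) *\<^sub>R R (R x)" for x
    by (simp add: N_def N'_def R_def lin red algebra_simps)
  have N'N: "N' (N x) = (1/4) *\<^sub>R S (S x)" for x
    by (simp add: N_def N'_def S_def lin red algebra_simps)

  have "normal_op (mean_transform T) \<longleftrightarrow> (\<forall>x. R (R x) = S (S x))"
    by (simp add: normal_op_def M N N' fun_eq_iff NN' N'N)
  also have "\<dots> \<longleftrightarrow> R = S" using positive_op_sqrt_unique[OF R S] by auto
  finally have 12: "normal_op (mean_transform T) \<longleftrightarrow> W \<circ> P \<circ> V = V \<circ> P \<circ> W"
    by (auto simp: fun_eq_iff R_def S_def)

  have 23: "W \<circ> P \<circ> V = V \<circ> P \<circ> W \<longleftrightarrow> V \<circ> V \<circ> P = P \<circ> V \<circ> V"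
  proof
    assume "W \<circ> P \<circ> V = V \<circ> P \<circ> W"
    hence "V (W (P (V (V x)))) = V (V (P (W (V x))))" for x by (simp add: fun_eq_iff)
    thus "V \<circ> V \<circ> P = P \<circ> V \<circ> V" by (simp add: fun_eq_iff red)
  next
    assume "V \<circ> V \<circ> P = P \<circ> V \<circ> V"
    hence "W (V (V (P (W x)))) = W (P (V (V (W x))))" for x by (simp add: fun_eq_iff)
    thus "W \<circ> P \<circ> V = V \<circ> P \<circ> W" by (simp add: fun_eq_iff red)
  qed

  have "mean_transform (cadjoint T) = cadjoint (mean_transform T) \<longleftrightarrow> (\<forall>x. V (P (W (W x))) = W (P x))"
    by (simp add: M M' N' N'_def fun_eq_iff)
  also have "\<dots> \<longleftrightarrow> V \<circ> V \<circ> P = P \<circ> V \<circ> V"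
  proof
    assume "\<forall>x. V (P (W (W x))) = W (P x)"
    hence "V (V (P (W (W (V (V x)))))) = V (W (P (V (V x))))" for x by simp
    thus "V \<circ> V \<circ> P = P \<circ> V \<circ> V" by (simp add: fun_eq_iff red)
  next
    assume "V \<circ> V \<circ> P = P \<circ> V \<circ> V"
    hence "W (V (V (P (W (W x))))) = W (P (V (V (W (W x)))))" for x by (simp add: fun_eq_iff)
    thus "\<forall>x. V (P (W (W x))) = W (P x)" by (simp add: red)
  qed
  finally show ?thesis using 12 23 by (simp add: P_def W_def)
qed

end
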